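(* Let $\mathcal{H}$ be a complex Hilbert space, let $L$ be a fixed Banach limit, and let $T$ be a powerbounded operator on $\mathcal{H}$ for which $A_{T,L}\neq0$. Then $$\|A_{T,L}\|\ge 1.$$
   Context: $\mathcal{H}$ is not necessarily finite dimensional. A bounded linear operator $T$ on $\mathcal{H}$ is powerbounded if there is $M>0$ such that $\|T^n\|<M$ for all $n\in\mathbb{N}=\{1,2,\dots\}$ (operator norm). A Banach limit is a bounded linear functional $L:\ell^\infty\to\mathbb{C}$ on bounded complex sequences such that $\|L\|=1$, $L(x)=\lim_n x_n$ for every convergent sequence $x$, $L$ is positive ($x_n\ge 0$ for all $n$ implies $L(x)\ge0$), and $L$ is shift-invariant ($L((x_n)_n)=L((x_{n+1})_n)$). For powerbounded $T$, the $L$-asymptotic limit $A_{T,L}$ is the unique positive bounded operator on $\mathcal{H}$ with $\langle A_{T,L}x,y\rangle = L\big((\langle T^nx,T^ny\rangle)_{n\ge1}\big)$ for all $x,y\in\mathcal{H}$. *)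

theory Defs
  imports "HOL-Analysis.Analysis"
begin

section \<open>Complex Hilbert spaces\<close>

class complex_vector = real_vector +
  fixes scaleC :: "complex \<Rightarrow> 'a \<Rightarrow> 'a"  (infixr \<open>*\<^sub>C\<close> 75)
  assumes scaleC_add_right: "a *\<^sub>C (x + y) = a *\<^sub>C x + a *\<^sub>C y"
    and scaleC_add_left: "(a + b) *\<^sub>C x = a *\<^sub>C x + b *\<^sub>C x"
    and scaleC_scaleC: "a *\<^sub>C (b *\<^sub>C x) = (a * b) *\<^sub>C x"
    and scaleC_of_real: "complex_of_real r *\<^sub>C x = r *\<^sub>R x"

class complex_normed_vector = complex_vector + real_normed_vector +
  assumes norm_scaleC: "norm (a *\<^sub>C x) = cmod a * norm x"

text \<open>
  The inner product is linear in its first argument.  The axiom \<open>cinner_self\<close>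
  says at once that it is positive definite and that it induces the norm.
\<close>

class complex_inner = complex_normed_vector +
  fixes cinner :: "'a \<Rightarrow> 'a \<Rightarrow> complex"
  assumes cinner_commute: "cinner x y = cnj (cinner y x)"
    and cinner_add_left: "cinner (x + y) z = cinner x z + cinner y z"
    and cinner_scaleC_left: "cinner (a *\<^sub>C x) y = a * cinner x y"
    and cinner_self: "cinner x x = complex_of_real ((norm x)\<^sup>2)"

class chilbert_space = complex_inner + complete_space

instantiation complex :: chilbert_space
begin

definition scaleC_complex :: "complex \<Rightarrow> complex \<Rightarrow> complex"
  where "scaleC_complex a x = a * x"

definition cinner_complex :: "complex \<Rightarrow> complex \<Rightarrow> complex"
  where "cinner_complex x y = x * cnj y"

instance
  by standard
    (simp_all add: scaleC_complex_def cinner_complex_def algebra_simps norm_mult scaleR_conv_of_real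
      complex_norm_square del: of_real_power)

end


section \<open>Bounded complex sequences\<close>

text \<open>
  Since \<^typ>\<open>nat\<close> is discrete, \<^typ>\<open>nat \<Rightarrow>\<^sub>C complex\<close> consists of all bounded complex
  sequences, with the supremum norm.  A sequence $(x_1, x_2, \dots)$ is represented
  by \<open>\<lambda>n. x (Suc n)\<close>.
\<close>

instantiation bcontfun :: (topological_space, complex_normed_vector) complex_normed_vector
begin

definition scaleC_bcontfun :: "complex \<Rightarrow> ('a \<Rightarrow>\<^sub>C 'b) \<Rightarrow> 'a \<Rightarrow>\<^sub>C 'b"
  where "scaleC_bcontfun a f = Bcontfun (\<lambda>x. a *\<^sub>C apply_bcontfun f x)"

lemma bounded_linear_scaleC: "bounded_linear (\<lambda>x :: 'b. a *\<^sub>C x)"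
proof (rule bounded_linear_intro)
  show "a *\<^sub>C (r *\<^sub>R x) = r *\<^sub>R (a *\<^sub>C x)" for r and x :: 'b
    by (simp add: scaleC_of_real[symmetric] scaleC_scaleC mult.commute)
  show "norm (a *\<^sub>C x) \<le> norm x * cmod a" for x :: 'b
    by (simp add: norm_scaleC mult.commute)
qed (rule scaleC_add_right)

lemma apply_scaleC_bcontfun [simp]:
  "apply_bcontfun (a *\<^sub>C f) x = a *\<^sub>C apply_bcontfun f x" for f :: "'a \<Rightarrow>\<^sub>C 'b"
proof -
  have "(\<lambda>x. a *\<^sub>C apply_bcontfun f x) \<in> bcontfun"
  proof (rule bcontfun_normI)
    show "continuous_on UNIV (\<lambda>x. a *\<^sub>C apply_bcontfun f x)"
      by (intro bounded_linear.continuous_on[OF bounded_linear_scaleC]) simp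
    show "norm (a *\<^sub>C apply_bcontfun f x) \<le> cmod a * norm f" for x
      by (simp add: norm_scaleC mult_left_mono norm_bounded)
  qed
  then show ?thesis
    by (simp add: scaleC_bcontfun_def Bcontfun_inverse)
qed

instance
proof
  fix a b :: complex and r :: real and f g :: "'a \<Rightarrow>\<^sub>C 'b"
  show "a *\<^sub>C (f + g) = a *\<^sub>C f + a *\<^sub>C g" "(a + b) *\<^sub>C f = a *\<^sub>C f + b *\<^sub>C f"
    "a *\<^sub>C b *\<^sub>C f = (a * b) *\<^sub>C f"
    by (auto intro!: bcontfun_eqI simp: scaleC_add_right scaleC_add_left scaleC_scaleC)
  show real: "complex_of_real r *\<^sub>C f = r *\<^sub>R f" for r and f :: "'a \<Rightarrow>\<^sub>C 'b"
    by (auto intro!: bcontfun_eqI simp: scaleC_of_real)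
  have le: "norm (c *\<^sub>C h) \<le> cmod c * norm h" for c and h :: "'a \<Rightarrow>\<^sub>C 'b"
    by (rule norm_bound) (simp add: norm_scaleC mult_left_mono norm_bounded)
  show "norm (a *\<^sub>C f) = cmod a * norm f"
  proof (cases "a = 0")
    case True
    then show ?thesis using real[of 0 f] by simp
  next
    case False
    have "inverse a *\<^sub>C (a *\<^sub>C f) = f"
      by (rule bcontfun_eqI) (use False scaleC_of_real[of 1] in \<open>simp add: scaleC_scaleC\<close>)
    then have "norm f \<le> cmod (inverse a) * norm (a *\<^sub>C f)"
      using le[of "inverse a" "a *\<^sub>C f"] by simp
    then have "cmod a * norm f \<le> norm (a *\<^sub>C f)"
      using False by (simp add: norm_divide field_simps)
    with le[of a f] show ?thesis by simp
  qed
qed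

end


section \<open>Operators and Banach limits\<close>

definition bounded_clinear :: "('a::complex_normed_vector \<Rightarrow> 'b::complex_normed_vector) \<Rightarrow> bool"
  where "bounded_clinear f \<longleftrightarrow> bounded_linear f \<and> (\<forall>a x. f (a *\<^sub>C x) = a *\<^sub>C f x)"

definition positive_operator :: "('a::complex_inner \<Rightarrow> 'a) \<Rightarrow> bool"
  where "positive_operator A \<longleftrightarrow> bounded_clinear A \<and> (\<forall>x. cinner (A x) x \<in> \<real>\<^sub>\<ge>\<^sub>0)"

definition powerbounded :: "('a::complex_normed_vector \<Rightarrow> 'a) \<Rightarrow> bool"
  where "powerbounded T \<longleftrightarrow> bounded_clinear T \<and> (\<exists>M>0. \<forall>n\<ge>1. onorm (T ^^ n) < M)"

definition banach_limit :: "((nat \<Rightarrow>\<^sub>C complex) \<Rightarrow> complex) \<Rightarrow> bool"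
  where "banach_limit L \<longleftrightarrow>
    bounded_clinear L \<and>
    onorm L = 1 \<and>
    (\<forall>x l. apply_bcontfun x \<longlonglongrightarrow> l \<longrightarrow> L x = l) \<and>
    (\<forall>x. (\<forall>n. apply_bcontfun x n \<in> \<real>\<^sub>\<ge>\<^sub>0) \<longrightarrow> L x \<in> \<real>\<^sub>\<ge>\<^sub>0) \<and>
    (\<forall>x. L x = L (Bcontfun (\<lambda>n. apply_bcontfun x (Suc n))))"

text \<open>
  For powerbounded \<open>T\<close> the sequence below is bounded, so \<^const>\<open>Bcontfun\<close> is applied
  to an element of \<^const>\<open>bcontfun\<close>; existence and uniqueness of the operator \<open>A\<close> then
  follow from the Riesz representation theorem.
\<close>

definition asymptotic_limit ::
    "((nat \<Rightarrow>\<^sub>C complex) \<Rightarrow> complex) \<Rightarrow> ('a::chilbert_space \<Rightarrow> 'a) \<Rightarrow> 'a \<Rightarrow> 'a"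
  where "asymptotic_limit L T = (THE A. positive_operator A \<and>
    (\<forall>x y. cinner (A x) y = L (Bcontfun (\<lambda>n. cinner ((T ^^ Suc n) x) ((T ^^ Suc n) y)))))"

end

theory Submission
  imports Defs
begin

text \<open>
  By shift invariance of \<open>L\<close>, the quadratic form of \<open>A = A\<^sub>T\<^sub>,\<^sub>L\<close> is \<open>T\<close>-invariant, so
  \<open>\<langle>Ax,x\<rangle> = \<langle>AT\<^sup>nx,T\<^sup>nx\<rangle> \<le> \<parallel>A\<parallel> \<parallel>T\<^sup>nx\<parallel>\<^sup>2\<close> for every \<open>n\<close>.  Applying \<open>L\<close> to this inequality
  gives \<open>\<langle>Ax,x\<rangle> \<le> \<parallel>A\<parallel> \<langle>Ax,x\<rangle>\<close>, and \<open>\<langle>Ax,x\<rangle> > 0\<close> for some \<open>x\<close> by polarization.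
\<close>

section \<open>Complex inner products\<close>

lemma cinner_add_right: "cinner x (y + z) = cinner x y + cinner x (z :: 'a::complex_inner)"
  by (metis cinner_add_left cinner_commute complex_cnj_add)

lemma cinner_scaleC_right: "cinner x (a *\<^sub>C y) = cnj a * cinner x (y :: 'a::complex_inner)"
  by (metis cinner_scaleC_left cinner_commute complex_cnj_mult)

lemma cinner_zero_left [simp]: "cinner 0 (y :: 'a::complex_inner) = 0"
  using cinner_add_left[of 0 0 y] by simp

lemma cinner_diff_left: "cinner (x - y) z = cinner x z - cinner y (z :: 'a::complex_inner)"
  using cinner_add_left[of "x - y" y z] by simp

lemma norm_add_square:
  "(norm (x + y))\<^sup>2 = (norm x)\<^sup>2 + (norm y)\<^sup>2 + 2 * Re (cinner x (y :: 'a::complex_inner))"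
proof -
  have "Re (cinner (x + y) (x + y))
      = Re (cinner x x) + Re (cinner y y) + Re (cinner x y) + Re (cinner y x)"
    by (simp only: cinner_add_left cinner_add_right plus_complex.sel)
  also have "Re (cinner y x) = Re (cinner x y)"
    by (subst cinner_commute) simp
  finally show ?thesis
    by (simp only: cinner_self Re_complex_of_real)
qed

lemma cinner_scaleR_left: "cinner (r *\<^sub>R x) (y :: 'a::complex_inner) = of_real r * cinner x y"
  by (metis scaleC_of_real cinner_scaleC_left)

lemma cinner_eqI:
  fixes u v :: "'a::complex_inner"
  assumes "\<And>y. cinner u y = cinner v y"
  shows "u = v"
  using cinner_self[of "u - v"] assms by (simp add: cinner_diff_left)

text \<open>Cauchy-Schwarz is read off from the triangle inequality, which the normed class already
  supplies: square both sides and cancel \<open>(norm x)\<^sup>2\<close> and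
  \<open>(norm y)\<^sup>2\<close>.\<close>

lemma Re_cinner_le: "Re (cinner x y) \<le> norm x * norm (y :: 'a::complex_inner)"
proof -
  have "(norm (x + y))\<^sup>2 \<le> (norm x + norm y)\<^sup>2"
    by (intro power_mono norm_triangle_ineq) simp
  then show ?thesis
    unfolding norm_add_square by (simp add: power2_sum)
qed

lemma cmod_cinner_le: "cmod (cinner x y) \<le> norm x * norm (y :: 'a::complex_inner)"
proof (cases "cinner x y = 0")
  case False
  \<comment> \<open>This unimodular factor rotates \<open>cinner x y\<close> onto the nonnegative
    real axis, where real part and modulus agree.\<close>
  define a where "a = cnj (sgn (cinner x y))"
  have "a * cinner x y = of_real (cmod (cinner x y))"
    using False complex_norm_square[of "cinner x y"]
    by (simp add: a_def sgn_div_norm scaleR_conv_of_real field_simps power2_eq_square)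
  moreover have "cmod a = 1"
    using False by (simp add: a_def norm_sgn)
  ultimately show ?thesis
    using Re_cinner_le[of "a *\<^sub>C x" y] by (simp add: cinner_scaleC_left norm_scaleC)
qed simp

text \<open>Complex scalars are essential here: a quarter turn of the real plane has zero quadratic
  form. The contrapositive supplies a vector at which the form of a nonzero operator does not
  vanish.\<close>

lemma cinner_polarization_zero:
  fixes A :: "'a::complex_inner \<Rightarrow> 'a"
  assumes A: "bounded_clinear A" and zero: "\<And>x. cinner (A x) x = 0"
  shows "A = (\<lambda>x. 0)"
proof
  fix x
  have add: "A (u + v) = A u + A v" and scale: "A (c *\<^sub>C u) = c *\<^sub>C A u" for u v c
    using A by (auto simp: bounded_clinear_def linear_simps)
  have sym: "cinner (A u) v + cinner (A v) u = 0" for u v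
    using zero[of "u + v"] by (simp add: add cinner_add_left cinner_add_right zero add.commute)
  \<comment> \<open>Putting \<open>\<i> *\<^sub>C y\<close> for \<open>y\<close> turns the sum in
    \<open>sym\<close> into a multiple of the difference of the same two terms, so both terms
    vanish.\<close>
  have "cinner (A x) y = cinner 0 y" for y
    using sym[of x y] sym[of x "\<i> *\<^sub>C y"]
    by (simp add: scale cinner_scaleC_left cinner_scaleC_right)
  then show "A x = 0"
    by (rule cinner_eqI)
qed

section \<open>The Riesz representation theorem\<close>

text \<open>The representing vector minimizes \<open>\<parallel>v\<parallel>\<^sup>2 - 2 f(v)\<close>.\<close>

lemma riesz_real:
  fixes f :: "'a::chilbert_space \<Rightarrow> real"
  assumes f: "bounded_linear f"
  obtains z where "\<And>y. f y = Re (cinner y z)"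
proof -
  interpret f: bounded_linear f by fact
  define J where "J v = (norm v)\<^sup>2 - 2 * f v" for v
  define m where "m = Inf (range J)"
  \<comment> \<open>Complete the square in \<open>norm v\<close>, after estimating
    \<open>f v\<close> by \<open>onorm f * norm v\<close>.\<close>
  have lower: "- (onorm f)\<^sup>2 \<le> J v" for v
  proof -
    have "f v \<le> onorm f * norm v"
      using onorm[OF f, of v] by simp
    moreover have "0 \<le> (norm v - onorm f)\<^sup>2" by simp
    ultimately show ?thesis by (simp add: J_def power2_diff algebra_simps)
  qed
  have bdd: "bdd_below (range J)"
    using lower by (intro bdd_belowI[of _ "- (onorm f)\<^sup>2"]) auto
  have m_le: "m \<le> J v" for v
    unfolding m_def by (intro cInf_lower bdd) auto
  \<comment> \<open>By the parallelogram law the left side equals \<open>2 * J u + 2 * J v\<close>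
    minus four times \<open>J\<close> at the midpoint, and that midpoint value is at least
    \<open>m\<close>. Hence every minimizing sequence is Cauchy.\<close>
  have par: "(norm (u - v))\<^sup>2 \<le> 2 * (J u - m) + 2 * (J v - m)" for u v
  proof -
    have "(norm (u - v))\<^sup>2 + (norm (u + v))\<^sup>2 = 2 * (norm u)\<^sup>2 + 2 * (norm v)\<^sup>2"
      using norm_add_square[of u v] norm_add_square[of u "- v"] cinner_scaleR_left[of "-1" v u]
        cinner_commute[of u v] cinner_commute[of u "- v"] by simp
    moreover have "J ((1/2) *\<^sub>R (u + v)) = (norm (u + v))\<^sup>2 / 4 - f u - f v"
      by (simp add: J_def f.scaleR f.add power_divide add_divide_distrib)
    ultimately show ?thesis
      using m_le[of "(1/2) *\<^sub>R (u + v)"] by (simp add: J_def)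
  qed
  have "\<exists>v. J v < m + inverse (real (Suc n))" for n
    using cInf_lessD[of "range J" "m + inverse (real (Suc n))"] by (auto simp: m_def)
  then obtain v where v: "\<And>n. J (v n) < m + inverse (real (Suc n))"
    by metis
  have "Cauchy v"
  proof (rule metric_CauchyI)
    fix e :: real assume e: "0 < e"
    obtain N where N: "inverse (real (Suc N)) < e\<^sup>2 / 4"
      using reals_Archimedean[of "e\<^sup>2 / 4"] e by auto
    show "\<exists>M. \<forall>m\<ge>M. \<forall>n\<ge>M. dist (v m) (v n) < e"
    proof (intro exI[of _ N] allI impI)
      have small: "J (v k) - m < e\<^sup>2 / 4" if "N \<le> k" for k
      proof -
        have "J (v k) - m < inverse (real (Suc k))"
          using v[of k] by (simp add: algebra_simps)
        also have "\<dots> \<le> inverse (real (Suc N))"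
          using that by (intro le_imp_inverse_le) auto
        also note N
        finally show ?thesis .
      qed
      fix i j assume "N \<le> i" "N \<le> j"
      then have "(norm (v i - v j))\<^sup>2 < e\<^sup>2"
        using par[of "v i" "v j"] small[of i] small[of j] by (simp add: field_simps)
      then show "dist (v i) (v j) < e"
        using e by (simp add: dist_norm power_less_imp_less_base)
    qed
  qed
  then obtain z where z: "v \<longlonglongrightarrow> z"
    using Cauchy_convergent_iff convergent_def by blast
  have "(\<lambda>n. J (v n)) \<longlonglongrightarrow> J z"
    unfolding J_def by (intro tendsto_intros f.tendsto z)
  moreover have "(\<lambda>n. m + inverse (real (Suc n))) \<longlonglongrightarrow> m + 0"
    by (intro tendsto_intros LIMSEQ_inverse_real_of_nat)
  ultimately have "J z \<le> m"
    using v by (auto intro: LIMSEQ_le less_imp_le)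
  then have min: "J z \<le> J w" for w
    using m_le order_trans by blast
  have "f y = Re (cinner y z)" for y
  proof (rule ccontr)
    assume neq: "f y \<noteq> Re (cinner y z)"
    \<comment> \<open>The derivative at \<open>t = 0\<close> of \<open>J\<close> along
      \<open>z + t *\<^sub>R y\<close> is \<open>2 * d\<close>, so a minimum at \<open>z\<close>
      forces \<open>d = 0\<close>.\<close>
    define d where "d = Re (cinner y z) - f y"
    \<comment> \<open>The added 1 keeps the division safe when \<open>y = 0\<close>; at
      \<open>t = - d / s\<close> the quadratic in \<open>quad\<close> is negative unless
      \<open>d = 0\<close>.\<close>
    define s where "s = (norm y)\<^sup>2 + 1"
    have quad: "0 \<le> t\<^sup>2 * (norm y)\<^sup>2 + 2 * t * d" for t
      using min[of "t *\<^sub>R y + z"] norm_add_square[of "t *\<^sub>R y" z]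
      by (simp add: J_def d_def f.add f.scaleR cinner_scaleR_left
          power_mult_distrib algebra_simps)
    have s: "s > 0" "(norm y)\<^sup>2 = s - 1"
      by (simp_all add: s_def add_nonneg_pos)
    have "(- d / s)\<^sup>2 * (s - 1) + 2 * (- d / s) * d = - (d\<^sup>2 * (s + 1)) / s\<^sup>2"
      using s(1) by (simp add: field_simps power2_eq_square)
    moreover have "d\<^sup>2 * (s + 1) / s\<^sup>2 > 0"
      using s(1) neq by (simp add: d_def)
    ultimately show False
      using quad[of "- d / s"] s(2) by simp
  qed
  then show thesis by (rule that)
qed

lemma riesz_representation:
  fixes g :: "'a::chilbert_space \<Rightarrow> complex"
  assumes g: "bounded_clinear g"
  obtains z where "\<And>y. g y = cinner y z"
proof -
  have "bounded_linear (\<lambda>y. Re (g y))"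
    using g by (auto simp: bounded_clinear_def intro: bounded_linear_compose[OF bounded_linear_Re])
  then obtain z where z: "\<And>y. Re (g y) = Re (cinner y z)"
    by (rule riesz_real) blast
  \<comment> \<open>Multiplication by \<open>\<i>\<close> turns imaginary parts into negated real
    parts, so the vector representing the real part of \<open>g\<close> represents all of
    \<open>g\<close>.\<close>
  have "Im (g y) = Im (cinner y z)" for y
    using z[of "\<i> *\<^sub>C y"] g
    by (simp add: bounded_clinear_def cinner_scaleC_left scaleC_complex_def)
  with z show thesis
    by (intro that) (simp add: complex_eq_iff)
qed

section \<open>Operator powers and asymptotic limits\<close>

text \<open>\<open>Bcontfun\<close> is meaningful only on bounded continuous functions. On
  \<open>nat\<close> continuity is automatic, so a uniform bound is all that has to be
  supplied.\<close>

lemma apply_Bcontfun_nat: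
  fixes f :: "nat \<Rightarrow> 'b::real_normed_vector"
  assumes "\<And>n. norm (f n) \<le> b"
  shows "apply_bcontfun (Bcontfun f) = f"
  using assms by (intro Bcontfun_inverse bcontfun_normI) auto

lemma powerbounded_power_bound:
  fixes T :: "'a::complex_normed_vector \<Rightarrow> 'a"
  assumes "powerbounded T"
  obtains M where "0 < M" "\<And>n x. norm ((T ^^ Suc n) x) \<le> M * norm x"
proof -
  obtain M where M: "M > 0" "\<And>n. n \<ge> 1 \<Longrightarrow> onorm (T ^^ n) < M"
    using assms by (auto simp: powerbounded_def)
  have T: "bounded_linear T"
    using assms by (simp add: powerbounded_def bounded_clinear_def)
  have "bounded_linear (T ^^ n)" for n
    by (induction n) (auto simp: o_def id_def intro: bounded_linear_compose[OF T])
  then have "norm ((T ^^ Suc n) x) \<le> onorm (T ^^ Suc n) * norm x" for n x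
    by (rule onorm)
  also have "onorm (T ^^ Suc n) * norm x \<le> M * norm x" for n x
    using M(2)[of "Suc n"] by (intro mult_right_mono) auto
  finally show thesis using that M(1) by blast
qed

text \<open>Unique existence gives the \<open>THE\<close> in \<open>asymptotic_limit\<close> its
  meaning. The form \<open>B\<close> obtained by applying \<open>L\<close> is bounded and
  sesquilinear, so Riesz represents it by an operator, which inherits positivity from
  \<open>L\<close>.\<close>

lemma asymptotic_limit_exists1:
  fixes T :: "'a::chilbert_space \<Rightarrow> 'a"
  assumes L: "banach_limit L" and T: "powerbounded T"
  shows "\<exists>!A. positive_operator A \<and>
    (\<forall>x y. cinner (A x) y = L (Bcontfun (\<lambda>n. cinner ((T ^^ Suc n) x) ((T ^^ Suc n) y))))"
proof -
  obtain M where M: "0 < M" "\<And>n x. norm ((T ^^ Suc n) x) \<le> M * norm x"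
    using powerbounded_power_bound[OF T] by blast
  interpret L: bounded_linear L
    using L by (simp add: banach_limit_def bounded_clinear_def)
  have Lscale: "L (a *\<^sub>C s) = a * L s" for a s
    using L by (simp add: banach_limit_def bounded_clinear_def scaleC_complex_def)
  have Lnorm: "cmod (L s) \<le> norm s" for s
    using onorm[OF L.bounded_linear_axioms, of s] L by (simp add: banach_limit_def)
  have Tadd: "(T ^^ n) (x + y) = (T ^^ n) x + (T ^^ n) y"
    and Tscale: "(T ^^ n) (a *\<^sub>C x) = a *\<^sub>C (T ^^ n) x" for n x y a
    using T by (induction n) (auto simp: powerbounded_def bounded_clinear_def linear_simps)
  define S where "S x y = Bcontfun (\<lambda>n. cinner ((T ^^ Suc n) x) ((T ^^ Suc n) y))" for x y
  have bound: "cmod (cinner ((T ^^ Suc n) x) ((T ^^ Suc n) y)) \<le> M\<^sup>2 * norm x * norm y" for n x y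
  proof -
    have "cmod (cinner ((T ^^ Suc n) x) ((T ^^ Suc n) y)) \<le> (M * norm x) * (M * norm y)"
      by (intro order_trans[OF cmod_cinner_le] mult_mono M) (use M(1) in auto)
    then show ?thesis by (simp add: power2_eq_square mult_ac)
  qed
  have S: "apply_bcontfun (S x y) n = cinner ((T ^^ Suc n) x) ((T ^^ Suc n) y)" for x y n
    unfolding S_def by (simp only: apply_Bcontfun_nat[OF bound])
  have Snorm: "norm (S x y) \<le> M\<^sup>2 * norm x * norm y" for x y
    by (rule norm_bound) (unfold S, rule bound)
  define B where "B x y = L (S x y)" for x y
  have Bnorm: "cmod (B x y) \<le> M\<^sup>2 * norm x * norm y" for x y
    unfolding B_def using Lnorm Snorm order_trans by blast
  have Badd: "B (x + y) z = B x z + B y z" "B z (x + y) = B z x + B z y" for x y z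
    unfolding B_def L.add[symmetric]
    by (rule arg_cong[of _ _ L], rule bcontfun_eqI,
        simp add: S Tadd cinner_add_left cinner_add_right del: funpow.simps)+
  have Bscale: "B (a *\<^sub>C x) y = a * B x y" "B x (a *\<^sub>C y) = cnj a * B x y" for a x y
    unfolding B_def Lscale[symmetric]
    by (rule arg_cong[of _ _ L], rule bcontfun_eqI,
        simp add: S Tscale cinner_scaleC_left cinner_scaleC_right scaleC_complex_def
          del: funpow.simps)+
  \<comment> \<open>\<open>B x\<close> is conjugate-linear, so Riesz is applied to its complex
    conjugate.\<close>
  have "\<exists>z. \<forall>y. cinner z y = B x y" for x
  proof -
    have "bounded_clinear (\<lambda>y. cnj (B x y))"
      unfolding bounded_clinear_def
    proof (intro conjI allI)
      show "bounded_linear (\<lambda>y. cnj (B x y))"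
      proof (rule bounded_linear_intro)
        show "cnj (B x (r *\<^sub>R y)) = r *\<^sub>R cnj (B x y)" for r y
          by (simp add: Bscale scaleC_of_real[symmetric] scaleC_complex_def)
        show "norm (cnj (B x y)) \<le> norm y * (M\<^sup>2 * norm x)" for y
          using Bnorm[of x y] by (simp add: mult_ac)
      qed (simp add: Badd)
    qed (simp add: Bscale scaleC_complex_def)
    then obtain z where z: "\<And>y. cnj (B x y) = cinner y z"
      by (rule riesz_representation) blast
    have "cinner z y = B x y" for y
      using z[of y] by (metis cinner_commute complex_cnj_cnj)
    then show ?thesis by blast
  qed
  then obtain A where A: "\<And>x y. cinner (A x) y = B x y"
    by metis
  have Ascale: "A (a *\<^sub>C x) = a *\<^sub>C A x" for a x
    by (rule cinner_eqI) (simp add: A Bscale cinner_scaleC_left)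
  have "bounded_linear A"
  proof (rule bounded_linear_intro)
    show "A (x + y) = A x + A y" for x y
      by (rule cinner_eqI) (simp add: A Badd cinner_add_left)
    show "A (r *\<^sub>R x) = r *\<^sub>R A x" for r x
      using Ascale[of "of_real r" x] by (simp add: scaleC_of_real)
    show "norm (A x) \<le> norm x * M\<^sup>2" for x
    proof (cases "A x = 0")
      case False
      \<comment> \<open>Test the bound on the form with \<open>y = A x\<close>; one factor
        \<open>norm (A x)\<close> then cancels.\<close>
      have "(norm (A x))\<^sup>2 \<le> M\<^sup>2 * norm x * norm (A x)"
        using Bnorm[of x "A x"] unfolding A[symmetric] cinner_self by (simp add: norm_power)
      with False show ?thesis by (simp add: power2_eq_square mult_ac)
    qed (use M(1) in simp)
  qed
  moreover have "cinner (A x) x \<in> \<real>\<^sub>\<ge>\<^sub>0" for x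
  proof -
    have "apply_bcontfun (S x x) n \<in> \<real>\<^sub>\<ge>\<^sub>0" for n
      unfolding S cinner_self nonneg_Reals_of_real_iff by simp
    then show ?thesis
      using L by (simp add: A B_def banach_limit_def)
  qed
  ultimately have "positive_operator A"
    using Ascale by (simp add: positive_operator_def bounded_clinear_def)
  moreover have "A' = A" if "\<forall>x y. cinner (A' x) y = B x y" for A'
    by (rule ext, rule cinner_eqI) (simp add: that A)
  ultimately show ?thesis
    unfolding S_def[symmetric] B_def[symmetric] using A by blast
qed

lemma asymptotic_limit:
  fixes T :: "'a::chilbert_space \<Rightarrow> 'a"
  assumes "banach_limit L" and "powerbounded T"
  shows positive_operator_asymptotic_limit: "positive_operator (asymptotic_limit L T)"
    and cinner_asymptotic_limit: "cinner (asymptotic_limit L T x) y =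
      L (Bcontfun (\<lambda>n. cinner ((T ^^ Suc n) x) ((T ^^ Suc n) y)))"
  using theI'[OF asymptotic_limit_exists1[OF assms]]
  unfolding asymptotic_limit_def[symmetric] by auto

theorem theorem6:
  fixes L :: "(nat \<Rightarrow>\<^sub>C complex) \<Rightarrow> complex"
    and T :: "'a::chilbert_space \<Rightarrow> 'a"
  assumes "banach_limit L"
    and "powerbounded T"
    and "asymptotic_limit L T \<noteq> (\<lambda>x. 0)"
  shows "onorm (asymptotic_limit L T) \<ge> 1"
proof -
  define A where "A = asymptotic_limit L T"
  define s where "s x = Bcontfun (\<lambda>n. complex_of_real ((norm ((T ^^ Suc n) x))\<^sup>2))" for x
  have pos: "positive_operator A"
    unfolding A_def by (rule positive_operator_asymptotic_limit[OF assms(1,2)])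
  have lin: "bounded_linear A"
    using pos by (simp add: positive_operator_def bounded_clinear_def)
  have form: "cinner (A x) x = L (s x)" for x
    unfolding A_def s_def cinner_asymptotic_limit[OF assms(1,2)] cinner_self ..
  obtain M where M: "0 < M" "\<And>n x. norm ((T ^^ Suc n) x) \<le> M * norm x"
    using powerbounded_power_bound[OF assms(2)] by blast
  have bound: "cmod (of_real ((norm ((T ^^ Suc n) x))\<^sup>2)) \<le> (M * norm x)\<^sup>2" for n x
    unfolding norm_of_real by (simp add: M(2) power_mono del: funpow.simps)
  have s: "apply_bcontfun (s x) = (\<lambda>n. of_real ((norm ((T ^^ Suc n) x))\<^sup>2))" for x
    unfolding s_def by (rule apply_Bcontfun_nat[OF bound])
  \<comment> \<open>The sequence belonging to \<open>T x\<close> is that of \<open>x\<close> moved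
    by one place, so shift invariance applies.\<close>
  have "L (s (T x)) = L (s x)" for x
  proof -
    have "L (s x) = L (Bcontfun (\<lambda>n. apply_bcontfun (s x) (Suc n)))"
      using assms(1) by (simp add: banach_limit_def)
    also have "\<dots> = L (s (T x))"
      unfolding s by (simp add: s_def funpow_swap1)
    finally show ?thesis ..
  qed
  then have inv: "L (s ((T ^^ n) x)) = L (s x)" for n x
    by (induction n) simp_all
  obtain x where x: "L (s x) \<noteq> 0"
    using cinner_polarization_zero[of A] pos assms(3) form
    by (auto simp: positive_operator_def A_def)
  have "L (s x) \<in> \<real>\<^sub>\<ge>\<^sub>0"
    using pos form[of x] by (metis positive_operator_def)
  then obtain p where p: "L (s x) = of_real p" "p \<ge> 0"
    by (auto elim: nonneg_Reals_cases)
  \<comment> \<open>The exponent \<open>Suc n\<close> matches the indexing of \<open>s x\<close>, so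
    this is a termwise comparison of \<open>s x\<close> with a constant sequence.\<close>
  have le: "p \<le> onorm A * (norm ((T ^^ Suc n) x))\<^sup>2" for n
  proof -
    define u where "u = (T ^^ Suc n) x"
    have "p = Re (cinner (A u) u)"
      unfolding form u_def inv p(1) by simp
    also have "\<dots> \<le> norm (A u) * norm u"
      by (rule Re_cinner_le)
    also have "\<dots> \<le> onorm A * norm u * norm u"
      by (intro mult_right_mono onorm[OF lin]) simp
    finally show ?thesis
      by (simp add: u_def power2_eq_square mult_ac)
  qed
  interpret L: bounded_linear L
    using assms(1) by (simp add: banach_limit_def bounded_clinear_def)
  \<comment> \<open>\<open>L\<close> is complex-valued, so the comparison is passed through it as
    positivity of a difference. The constant sequence \<open>c\<close> converges, which fixes
    \<open>L c\<close> as \<open>p\<close>.\<close>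
  define c where "c = (const_bcontfun (of_real p) :: nat \<Rightarrow>\<^sub>C complex)"
  have c: "apply_bcontfun c = (\<lambda>n. of_real p)"
    by (simp add: c_def fun_eq_iff)
  have "apply_bcontfun c \<longlonglongrightarrow> of_real p"
    by (simp add: c)
  then have Lc: "L c = of_real p"
    using assms(1) by (auto simp: banach_limit_def)
  have "apply_bcontfun (onorm A *\<^sub>R s x - c) n \<in> \<real>\<^sub>\<ge>\<^sub>0" for n
  proof -
    have "apply_bcontfun (onorm A *\<^sub>R s x - c) n
        = of_real (onorm A * (norm ((T ^^ Suc n) x))\<^sup>2 - p)"
      by (simp add: s c scaleR_conv_of_real del: funpow.simps)
    then show ?thesis
      using le[of n] by (simp only: nonneg_Reals_of_real_iff diff_ge_0_iff_ge)
  qed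
  then have "L (onorm A *\<^sub>R s x - c) \<in> \<real>\<^sub>\<ge>\<^sub>0"
    using assms(1) by (simp add: banach_limit_def)
  then have "complex_of_real (onorm A * p - p) \<in> \<real>\<^sub>\<ge>\<^sub>0"
    by (simp add: L.diff L.scaleR Lc p(1) scaleR_conv_of_real)
  then have "p \<le> onorm A * p"
    by (simp only: nonneg_Reals_of_real_iff diff_ge_0_iff_ge)
  moreover have "p > 0"
    using p x by (cases "p = 0") auto
  ultimately show ?thesis
    by (simp add: A_def)
qed

end
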